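(* Let $n \ge 1$ and let $\lambda = \mathbf{2 \times n}$ be the rectangular Young diagram with $2$ rows and $n$ columns. Then the matrix $K_{\lambda}$ has full rank (equivalently, its rows are linearly independent).
   Context: Let $\lambda$ be a partition of $N$. A tableau of shape $\lambda$ is a filling of the Young diagram of $\lambda$ with the numbers $1,\dots,N$, each used once. Two tableaux are $h$-equivalent if one can be obtained from the other by permuting entries within rows and permuting rows of equal length; a horizontal tableau is an $h$-equivalence class, so its rows form a set partition of $\{1,\dots,N\}$ into blocks of sizes $\lambda_1,\lambda_2,\dots$. Similarly, two tableaux are $v$-equivalent if one can be obtained from the other by permuting entries within columns and permuting columns of equal length; a vertical tableau is a $v$-equivalence class, so its columns form a set partition of $\{1,\dots,N\}$. A horizontal tableau $\mu$ with rows $r_1,\dots,r_p$ and a vertical tableau $\nu$ with columns $c_1,\dots,c_q$ are orthogonal, written $\mu\perp\nu$, if $|r_i\cap c_j|\le 1$ for all $i,j$. The matrix $K_\lambda$ has rows indexed by horizontal tableaux of shape $\lambda$, columns indexed by vertical tableaux of shape $\lambda$, and entry $K_\lambda^{\mu,\nu}=1$ if $\mu\perp\nu$ and $0$ otherwise. For $\lambda=\mathbf{2\times n}$ (so $N=2n$), a horizontal tableau is an unordered partition of $\{1,\dots,2n\}$ into two $n$-element rows, and a vertical tableau is a partition of $\{1,\dots,2n\}$ into $n$ two-element columns. *)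

theory Defs
  imports "Jordan_Normal_Form.DL_Rank" "HOL-Combinatorics.Permutations"
begin

text \<open>
  A partition is the weakly decreasing list of its parts; rows and columns of the Young diagram are numbered from 0.
  A tableau is a bijection from the cells to \<open>{1..N}\<close>, taken to be \<open>undefined\<close> off the diagram so
  that fillings are equal iff they agree on the cells.
\<close>

definition cells :: "nat list \<Rightarrow> (nat \<times> nat) set" where
  "cells lam = {(i, j). i < length lam \<and> j < lam ! i}"

definition num_cols :: "nat list \<Rightarrow> nat" where
  "num_cols lam = Max (insert 0 (set lam))"

definition col_len :: "nat list \<Rightarrow> nat \<Rightarrow> nat" where
  "col_len lam j = card {i. (i, j) \<in> cells lam}"

type_synonym tableau = "nat \<times> nat \<Rightarrow> nat"

definition tableaux :: "nat list \<Rightarrow> tableau set" where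
  "tableaux lam = {T \<in> extensional (cells lam). bij_betw T (cells lam) {1..sum_list lam}}"

text \<open>
  Below, \<open>\<rho>\<close> permutes the rows (columns) of equal length, and \<open>\<pi> i\<close> (\<open>\<pi> j\<close>) permutes the entries
  inside a single row (column).
\<close>

definition h_equiv :: "nat list \<Rightarrow> tableau rel" where
  "h_equiv lam = {(T, S). T \<in> tableaux lam \<and> S \<in> tableaux lam \<and>
     (\<exists>\<rho> \<pi>. \<rho> permutes {..<length lam} \<and>
        (\<forall>i<length lam. lam ! \<rho> i = lam ! i \<and> \<pi> i permutes {..<lam ! i} \<and>
           (\<forall>j<lam ! i. S (i, j) = T (\<rho> i, \<pi> i j))))}"

definition v_equiv :: "nat list \<Rightarrow> tableau rel" where
  "v_equiv lam = {(T, S). T \<in> tableaux lam \<and> S \<in> tableaux lam \<and>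
     (\<exists>\<rho> \<pi>. \<rho> permutes {..<num_cols lam} \<and>
        (\<forall>j<num_cols lam. col_len lam (\<rho> j) = col_len lam j \<and> \<pi> j permutes {..<col_len lam j} \<and>
           (\<forall>i<col_len lam j. S (i, j) = T (\<pi> j i, \<rho> j))))}"

definition horizontal_tableaux :: "nat list \<Rightarrow> tableau set set" where
  "horizontal_tableaux lam = tableaux lam // h_equiv lam"

definition vertical_tableaux :: "nat list \<Rightarrow> tableau set set" where
  "vertical_tableaux lam = tableaux lam // v_equiv lam"

definition tableau_rows :: "nat list \<Rightarrow> tableau \<Rightarrow> nat set set" where
  "tableau_rows lam T = {{T (i, j) | j. (i, j) \<in> cells lam} | i. i < length lam}"

definition tableau_cols :: "nat list \<Rightarrow> tableau \<Rightarrow> nat set set" where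
  "tableau_cols lam T = {{T (i, j) | i. (i, j) \<in> cells lam} | j. j < num_cols lam}"

text \<open>
  Equivalent tableaux have the same rows (columns), see \<open>h_rows_eq\<close> and \<open>v_cols_eq\<close>, so the unions
  over a class are the rows (columns) of any representative.
\<close>

definition h_rows :: "nat list \<Rightarrow> tableau set \<Rightarrow> nat set set" where
  "h_rows lam \<mu> = (\<Union>T\<in>\<mu>. tableau_rows lam T)"

definition v_cols :: "nat list \<Rightarrow> tableau set \<Rightarrow> nat set set" where
  "v_cols lam \<nu> = (\<Union>T\<in>\<nu>. tableau_cols lam T)"

definition orthogonal_tableaux :: "nat list \<Rightarrow> tableau set \<Rightarrow> tableau set \<Rightarrow> bool" where
  "orthogonal_tableaux lam \<mu> \<nu> \<longleftrightarrow> (\<forall>r\<in>h_rows lam \<mu>. \<forall>c\<in>v_cols lam \<nu>. card (r \<inter> c) \<le> 1)"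

text \<open>
  The lists \<open>hs\<close> and \<open>vs\<close> are meant to enumerate, in any order and without repetition, the
  horizontal and the vertical tableaux.
\<close>

definition K_matrix ::
  "nat list \<Rightarrow> tableau set list \<Rightarrow> tableau set list \<Rightarrow> 'a::field_char_0 mat" where
  "K_matrix lam hs vs = mat (length hs) (length vs)
     (\<lambda>(i, j). if orthogonal_tableaux lam (hs ! i) (vs ! j) then 1 else 0)"

definition mat_rank :: "'a::field mat \<Rightarrow> nat" where
  "mat_rank A = vec_space.rank (dim_row A) A"

text \<open>Linear independence of the rows as a family; equal rows would collapse in \<open>set (rows A)\<close>.\<close>

definition rows_lin_indpt :: "'a::field mat \<Rightarrow> bool" where
  "rows_lin_indpt A \<longleftrightarrow> distinct (rows A) \<and>
     \<not> module.lin_dep class_ring (module_vec TYPE('a) (dim_col A)) (set (rows A))"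

lemma finite_cells: "finite (cells lam)"
proof -
  have "cells lam = (SIGMA i:{..<length lam}. {..<lam ! i})"
    by (auto simp: cells_def)
  then show ?thesis by simp
qed

lemma finite_tableaux: "finite (tableaux lam)"
proof (rule finite_subset)
  show "tableaux lam \<subseteq> cells lam \<rightarrow>\<^sub>E {1..sum_list lam}"
    by (auto simp: tableaux_def PiE_def bij_betw_def)
  show "finite (cells lam \<rightarrow>\<^sub>E {1..sum_list lam})"
    by (intro finite_PiE finite_cells) auto
qed

lemma equiv_h_equiv: "equiv (tableaux lam) (h_equiv lam)"
proof (rule equivI)
  show "h_equiv lam \<subseteq> tableaux lam \<times> tableaux lam"
    by (auto simp: h_equiv_def)
  show "refl_on (tableaux lam) (h_equiv lam)"
    unfolding refl_on_def h_equiv_def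
    by (auto intro!: exI[of _ id] exI[of _ "\<lambda>_. id"] simp: permutes_id)
  show "sym (h_equiv lam)"
  proof (rule symI)
    fix T S assume "(T, S) \<in> h_equiv lam"
    then obtain \<rho> \<pi> where TS: "T \<in> tableaux lam" "S \<in> tableaux lam"
      and \<rho>: "\<rho> permutes {..<length lam}"
      and \<pi>: "\<And>i. i < length lam \<Longrightarrow> lam ! \<rho> i = lam ! i \<and> \<pi> i permutes {..<lam ! i} \<and>
           (\<forall>j<lam ! i. S (i, j) = T (\<rho> i, \<pi> i j))"
      unfolding h_equiv_def by auto
    let ?r = "inv_into UNIV \<rho>" and ?p = "\<lambda>i. inv_into UNIV (\<pi> (inv_into UNIV \<rho> i))"
    have r: "?r permutes {..<length lam}" using \<rho> by (rule permutes_inv)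
    have "lam ! ?r i = lam ! i \<and> ?p i permutes {..<lam ! i} \<and>
           (\<forall>j<lam ! i. T (i, j) = S (?r i, ?p i j))" if i: "i < length lam" for i
    proof -
      have ri: "?r i < length lam" using permutes_in_image[OF r, of i] i by simp
      have \<rho>r: "\<rho> (?r i) = i" using \<rho> by (rule permutes_inverses)
      note P = \<pi>[OF ri, unfolded \<rho>r]
      have l: "lam ! ?r i = lam ! i" using P by simp
      have p: "\<pi> (?r i) permutes {..<lam ! i}" using P l by simp
      have pp: "?p i permutes {..<lam ! i}" using p by (rule permutes_inv)
      have "T (i, j) = S (?r i, ?p i j)" if j: "j < lam ! i" for j
      proof -
        have "?p i j < lam ! i" using permutes_in_image[OF pp, of j] j by simp
        then have "?p i j < lam ! ?r i" unfolding l .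
        from P[THEN conjunct2, THEN conjunct2, rule_format, OF this]
        show ?thesis by (simp add: permutes_inverses(1)[OF p])
      qed
      then show ?thesis using l pp by simp
    qed
    then show "(S, T) \<in> h_equiv lam" unfolding h_equiv_def using TS r
      by (intro CollectI case_prodI conjI exI[of _ ?r] exI[of _ ?p]) auto
  qed
  show "trans (h_equiv lam)"
  proof (rule transI)
    fix T S U assume "(T, S) \<in> h_equiv lam" "(S, U) \<in> h_equiv lam"
    then obtain \<rho> \<pi> \<rho>' \<pi>' where TS: "T \<in> tableaux lam" "U \<in> tableaux lam"
      and \<rho>: "\<rho> permutes {..<length lam}" "\<rho>' permutes {..<length lam}"
      and \<pi>: "\<And>i. i < length lam \<Longrightarrow> lam ! \<rho> i = lam ! i \<and> \<pi> i permutes {..<lam ! i} \<and>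
           (\<forall>j<lam ! i. S (i, j) = T (\<rho> i, \<pi> i j))"
      and \<pi>': "\<And>i. i < length lam \<Longrightarrow> lam ! \<rho>' i = lam ! i \<and> \<pi>' i permutes {..<lam ! i} \<and>
           (\<forall>j<lam ! i. U (i, j) = S (\<rho>' i, \<pi>' i j))"
      unfolding h_equiv_def by auto
    let ?r = "\<rho> \<circ> \<rho>'" and ?p = "\<lambda>i. \<pi> (\<rho>' i) \<circ> \<pi>' i"
    have "lam ! ?r i = lam ! i \<and> ?p i permutes {..<lam ! i} \<and>
           (\<forall>j<lam ! i. U (i, j) = T (?r i, ?p i j))" if i: "i < length lam" for i
    proof -
      have ri: "\<rho>' i < length lam" using permutes_in_image[OF \<rho>(2), of i] i by simp
      note P = \<pi>[OF ri] and P' = \<pi>'[OF i]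
      have "?p i permutes {..<lam ! i}" using P P' by (auto intro: permutes_compose)
      moreover have "\<pi>' i j < lam ! i" if "j < lam ! i" for j
        using permutes_in_image[of "\<pi>' i" "{..<lam ! i}" j] P' that by simp
      ultimately show ?thesis using P P' by simp
    qed
    then show "(T, U) \<in> h_equiv lam" unfolding h_equiv_def
      using TS permutes_compose[OF \<rho>(2,1)]
      by (intro CollectI case_prodI conjI exI[of _ ?r] exI[of _ ?p]) auto
  qed
qed

lemma equiv_v_equiv: "equiv (tableaux lam) (v_equiv lam)"
proof (rule equivI)
  show "v_equiv lam \<subseteq> tableaux lam \<times> tableaux lam"
    by (auto simp: v_equiv_def)
  show "refl_on (tableaux lam) (v_equiv lam)"
    unfolding refl_on_def v_equiv_def
    by (auto intro!: exI[of _ id] exI[of _ "\<lambda>_. id"] simp: permutes_id)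
  show "sym (v_equiv lam)"
  proof (rule symI)
    fix T S assume "(T, S) \<in> v_equiv lam"
    then obtain \<rho> \<pi> where TS: "T \<in> tableaux lam" "S \<in> tableaux lam"
      and \<rho>: "\<rho> permutes {..<num_cols lam}"
      and \<pi>: "\<And>j. j < num_cols lam \<Longrightarrow> col_len lam (\<rho> j) = col_len lam j \<and> \<pi> j permutes {..<col_len lam j} \<and>
           (\<forall>i<col_len lam j. S (i, j) = T (\<pi> j i, \<rho> j))"
      unfolding v_equiv_def by auto
    let ?r = "inv_into UNIV \<rho>" and ?p = "\<lambda>j. inv_into UNIV (\<pi> (inv_into UNIV \<rho> j))"
    have r: "?r permutes {..<num_cols lam}" using \<rho> by (rule permutes_inv)
    have "col_len lam (?r j) = col_len lam j \<and> ?p j permutes {..<col_len lam j} \<and>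
           (\<forall>i<col_len lam j. T (i, j) = S (?p j i, ?r j))" if j: "j < num_cols lam" for j
    proof -
      have rj: "?r j < num_cols lam" using permutes_in_image[OF r, of j] j by simp
      have \<rho>r: "\<rho> (?r j) = j" using \<rho> by (rule permutes_inverses)
      note P = \<pi>[OF rj, unfolded \<rho>r]
      have l: "col_len lam (?r j) = col_len lam j" using P by simp
      have p: "\<pi> (?r j) permutes {..<col_len lam j}" using P l by simp
      have pp: "?p j permutes {..<col_len lam j}" using p by (rule permutes_inv)
      have "T (i, j) = S (?p j i, ?r j)" if i: "i < col_len lam j" for i
      proof -
        have "?p j i < col_len lam j" using permutes_in_image[OF pp, of i] i by simp
        then have "?p j i < col_len lam (?r j)" unfolding l .
        from P[THEN conjunct2, THEN conjunct2, rule_format, OF this]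
        show ?thesis by (simp add: permutes_inverses(1)[OF p])
      qed
      then show ?thesis using l pp by simp
    qed
    then show "(S, T) \<in> v_equiv lam" unfolding v_equiv_def using TS r
      by (intro CollectI case_prodI conjI exI[of _ ?r] exI[of _ ?p]) auto
  qed
  show "trans (v_equiv lam)"
  proof (rule transI)
    fix T S U assume "(T, S) \<in> v_equiv lam" "(S, U) \<in> v_equiv lam"
    then obtain \<rho> \<pi> \<rho>' \<pi>' where TS: "T \<in> tableaux lam" "U \<in> tableaux lam"
      and \<rho>: "\<rho> permutes {..<num_cols lam}" "\<rho>' permutes {..<num_cols lam}"
      and \<pi>: "\<And>j. j < num_cols lam \<Longrightarrow> col_len lam (\<rho> j) = col_len lam j \<and> \<pi> j permutes {..<col_len lam j} \<and>
           (\<forall>i<col_len lam j. S (i, j) = T (\<pi> j i, \<rho> j))"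
      and \<pi>': "\<And>j. j < num_cols lam \<Longrightarrow> col_len lam (\<rho>' j) = col_len lam j \<and> \<pi>' j permutes {..<col_len lam j} \<and>
           (\<forall>i<col_len lam j. U (i, j) = S (\<pi>' j i, \<rho>' j))"
      unfolding v_equiv_def by auto
    let ?r = "\<rho> \<circ> \<rho>'" and ?p = "\<lambda>j. \<pi> (\<rho>' j) \<circ> \<pi>' j"
    have "col_len lam (?r j) = col_len lam j \<and> ?p j permutes {..<col_len lam j} \<and>
           (\<forall>i<col_len lam j. U (i, j) = T (?p j i, ?r j))" if j: "j < num_cols lam" for j
    proof -
      have rj: "\<rho>' j < num_cols lam" using permutes_in_image[OF \<rho>(2), of j] j by simp
      note P = \<pi>[OF rj] and P' = \<pi>'[OF j]
      have "?p j permutes {..<col_len lam j}" using P P' by (auto intro: permutes_compose)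
      moreover have "\<pi>' j i < col_len lam j" if "i < col_len lam j" for i
        using permutes_in_image[of "\<pi>' j" "{..<col_len lam j}" i] P' that by simp
      ultimately show ?thesis using P P' by simp
    qed
    then show "(T, U) \<in> v_equiv lam" unfolding v_equiv_def
      using TS permutes_compose[OF \<rho>(2,1)]
      by (intro CollectI case_prodI conjI exI[of _ ?r] exI[of _ ?p]) auto
  qed
qed

lemma tableau_rows_subset:
  assumes "(T, S) \<in> h_equiv lam"
  shows "tableau_rows lam S \<subseteq> tableau_rows lam T"
proof -
  obtain \<rho> \<pi> where \<rho>: "\<rho> permutes {..<length lam}"
    and \<pi>: "\<And>i. i < length lam \<Longrightarrow> lam ! \<rho> i = lam ! i \<and> \<pi> i permutes {..<lam ! i} \<and>
         (\<forall>j<lam ! i. S (i, j) = T (\<rho> i, \<pi> i j))"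
    using assms unfolding h_equiv_def by auto
  have "{S (i, j) | j. (i, j) \<in> cells lam} = {T (\<rho> i, j) | j. (\<rho> i, j) \<in> cells lam} \<and>
      \<rho> i < length lam" if i: "i < length lam" for i
  proof -
    have ri: "\<rho> i < length lam" using permutes_in_image[OF \<rho>, of i] i by simp
    have "{S (i, j) | j. (i, j) \<in> cells lam} = (\<lambda>j. S (i, j)) ` {..<lam ! i}"
      using i by (auto simp: cells_def)
    also have "\<dots> = (\<lambda>j. T (\<rho> i, \<pi> i j)) ` {..<lam ! i}"
      using \<pi>[OF i] by (intro image_cong) auto
    also have "\<dots> = (\<lambda>j. T (\<rho> i, j)) ` (\<pi> i ` {..<lam ! i})"
      by (simp add: image_image)
    also have "\<pi> i ` {..<lam ! i} = {..<lam ! i}"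
      using \<pi>[OF i] by (simp add: permutes_image)
    also have "(\<lambda>j. T (\<rho> i, j)) ` {..<lam ! i} = {T (\<rho> i, j) | j. (\<rho> i, j) \<in> cells lam}"
      using \<pi>[OF i] ri by (auto simp: cells_def)
    finally show ?thesis using ri by simp
  qed
  then show ?thesis unfolding tableau_rows_def by blast
qed

lemma h_rows_eq:
  assumes "T \<in> tableaux lam"
  shows "h_rows lam (h_equiv lam `` {T}) = tableau_rows lam T"
proof -
  have "tableau_rows lam S = tableau_rows lam T" if TS: "(T, S) \<in> h_equiv lam" for S
  proof
    have ST: "(S, T) \<in> h_equiv lam"
      using equiv_h_equiv[of lam] TS by (auto elim!: equivE dest: symD)
    show "tableau_rows lam S \<subseteq> tableau_rows lam T"
      by (rule tableau_rows_subset[OF TS])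
    show "tableau_rows lam T \<subseteq> tableau_rows lam S"
      by (rule tableau_rows_subset[OF ST])
  qed
  moreover have "(T, T) \<in> h_equiv lam"
    using equiv_class_self[OF equiv_h_equiv assms] by simp
  ultimately show ?thesis unfolding h_rows_def by blast
qed

lemma cells_col:
  assumes "sorted_wrt (\<ge>) lam"
  shows "(i, j) \<in> cells lam \<longleftrightarrow> i < col_len lam j"
proof -
  let ?A = "{i. (i, j) \<in> cells lam}"
  have fin: "finite ?A"
    by (rule finite_subset[of _ "{..<length lam}"]) (auto simp: cells_def)
  have dc: "k \<in> ?A" if "i \<in> ?A" "k \<le> i" for i k
  proof (cases "k = i")
    case False
    then have "lam ! k \<ge> lam ! i"
      using sorted_wrt_nth_less[OF assms, of k i] that by (auto simp: cells_def)
    then show ?thesis using that by (auto simp: cells_def)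
  qed (use that in simp)
  show ?thesis
  proof
    assume "(i, j) \<in> cells lam"
    then have "{..i} \<subseteq> ?A" using dc by auto
    then have "card {..i} \<le> card ?A" using fin by (rule card_mono[rotated])
    then show "i < col_len lam j" by (simp add: col_len_def)
  next
    assume "i < col_len lam j"
    show "(i, j) \<in> cells lam"
    proof (rule ccontr)
      assume "(i, j) \<notin> cells lam"
      then have "?A \<subseteq> {..<i}" using dc by (metis lessThan_iff mem_Collect_eq not_less subsetI)
      then have "card ?A \<le> i" using card_mono[of "{..<i}" ?A] by simp
      then show False using \<open>i < col_len lam j\<close> by (simp add: col_len_def)
    qed
  qed
qed

lemma tableau_cols_subset:
  assumes "sorted_wrt (\<ge>) lam" and "(T, S) \<in> v_equiv lam"
  shows "tableau_cols lam S \<subseteq> tableau_cols lam T"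
proof -
  note C = cells_col[OF assms(1)]
  obtain \<rho> \<pi> where \<rho>: "\<rho> permutes {..<num_cols lam}"
    and \<pi>: "\<And>j. j < num_cols lam \<Longrightarrow>
         col_len lam (\<rho> j) = col_len lam j \<and> \<pi> j permutes {..<col_len lam j} \<and>
         (\<forall>i<col_len lam j. S (i, j) = T (\<pi> j i, \<rho> j))"
    using assms unfolding v_equiv_def by auto
  have "{S (i, j) | i. (i, j) \<in> cells lam} = {T (i, \<rho> j) | i. (i, \<rho> j) \<in> cells lam} \<and>
      \<rho> j < num_cols lam" if j: "j < num_cols lam" for j
  proof -
    have rj: "\<rho> j < num_cols lam" using permutes_in_image[OF \<rho>, of j] j by simp
    have "{S (i, j) | i. (i, j) \<in> cells lam} = (\<lambda>i. S (i, j)) ` {..<col_len lam j}"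
      by (auto simp: C)
    also have "\<dots> = (\<lambda>i. T (\<pi> j i, \<rho> j)) ` {..<col_len lam j}"
      using \<pi>[OF j] by (intro image_cong) auto
    also have "\<dots> = (\<lambda>i. T (i, \<rho> j)) ` (\<pi> j ` {..<col_len lam j})"
      by (simp add: image_image)
    also have "\<pi> j ` {..<col_len lam j} = {..<col_len lam j}"
      using \<pi>[OF j] by (simp add: permutes_image)
    also have "(\<lambda>i. T (i, \<rho> j)) ` {..<col_len lam j} = {T (i, \<rho> j) | i. (i, \<rho> j) \<in> cells lam}"
      using \<pi>[OF j] by (auto simp: C)
    finally show ?thesis using rj by simp
  qed
  then show ?thesis unfolding tableau_cols_def by blast
qed

lemma v_cols_eq:
  assumes "sorted_wrt (\<ge>) lam" and "T \<in> tableaux lam"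
  shows "v_cols lam (v_equiv lam `` {T}) = tableau_cols lam T"
proof -
  have "tableau_cols lam S = tableau_cols lam T" if TS: "(T, S) \<in> v_equiv lam" for S
  proof
    have ST: "(S, T) \<in> v_equiv lam"
      using equiv_v_equiv[of lam] TS by (auto elim!: equivE dest: symD)
    show "tableau_cols lam S \<subseteq> tableau_cols lam T"
      by (rule tableau_cols_subset[OF assms(1) TS])
    show "tableau_cols lam T \<subseteq> tableau_cols lam S"
      by (rule tableau_cols_subset[OF assms(1) ST])
  qed
  moreover have "(T, T) \<in> v_equiv lam"
    using equiv_class_self[OF equiv_v_equiv assms(2)] by simp
  ultimately show ?thesis unfolding v_cols_def by blast
qed

lemma finite_horizontal_tableaux: "finite (horizontal_tableaux lam)"
  unfolding horizontal_tableaux_def quotient_def by (simp add: finite_tableaux)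

lemma finite_vertical_tableaux: "finite (vertical_tableaux lam)"
  unfolding vertical_tableaux_def quotient_def by (simp add: finite_tableaux)

end

theory Submission
  imports Defs "HOL-Analysis.Gamma_Function"
begin

text \<open>
  Represent a horizontal tableau by its row \<open>A\<close> containing 1, an \<open>n\<close>-subset of \<open>{1..2n}\<close>. For a fixed
  \<open>B\<close> of this kind, consider the \<open>n!\<close> vertical tableaux obtained by matching \<open>B\<close> with its complement.
  The number of them orthogonal to \<open>A\<close> is \<open>k! (n - k)!\<close> with \<open>k = card (A \<inter> B)\<close>, so \<open>K C = G\<close> for a suitable
  matrix \<open>C\<close> and \<open>G = (k! (n - k)!)\<close>, and it suffices that \<open>det G \<noteq> 0\<close>. As \<open>G\<close> is an integer matrix, this
  may be checked over the reals, where \<open>G\<close> is positive definite: up to the factor \<open>(n + 1)!\<close>, its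
  entries are the Beta integrals of \<open>t^k (1 - t)^(n - k)\<close>. With \<open>a\<^sup>2 = t\<close> and \<open>b\<^sup>2 = 1 - t\<close> the integrand
  is the product over \<open>x \<in> {1..2n}\<close> of \<open>a\<close> or \<open>b\<close>, according to whether \<open>A\<close> and \<open>B\<close> agree at \<open>x\<close>. This
  kernel is diagonalised by the characters \<open>A \<mapsto> (-1)^card (S - A)\<close>; symmetrised under \<open>t \<mapsto> 1 - t\<close> it is
  positive semidefinite for all \<open>t \<in> [0, 1]\<close>, and at \<open>t = 1\<close> it is the identity.
\<close>

subsection \<open>Positive definiteness\<close>

lemma beta_integral:
  "((\<lambda>t::real. t ^ k * (1 - t) ^ l) has_integral fact k * fact l / fact (k + l + 1)) {0..1}"
proof -
  have B: "Beta (real (Suc k)) (real (Suc l)) = fact k * fact l / fact (k + l + 1)"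
    unfolding Beta_def using Gamma_fact[of k, where 'a=real] Gamma_fact[of l, where 'a=real] Gamma_fact[of "k+l+1", where 'a=real]
    by (simp add: add_ac)
  have *: "((\<lambda>t. t powr (real (Suc k) - 1) * (1 - t) powr (real (Suc l) - 1))
      has_integral Beta (real (Suc k)) (real (Suc l))) {0..1}"
    by (rule has_integral_Beta_real) auto
  show ?thesis
    unfolding B[symmetric]
    \<comment> \<open>At the endpoints \<open>powr\<close> and the natural power can disagree
      (\<open>0 powr 0 = 0\<close>, but \<open>0 ^ 0 = 1\<close>), so the integrands are compared
      only off \<open>{0, 1}\<close>.\<close>
    by (rule has_integral_spike_finite[where S="{0,1}", OF _ _ *]) (auto simp: powr_realpow)
qed

section \<open>Character expansion of the agreement kernel\<close>

text \<open>Each factor is \<open>p + q * s\<close> with \<open>s\<close> a product of two signs,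
  one from \<open>A\<close> and one from \<open>B\<close>. Multiplying out over subsets of
  \<open>X\<close> therefore separates \<open>A\<close> from \<open>B\<close>.\<close>

lemma prod_agree_expand:
  fixes p q :: real
  assumes "finite X"
  defines "\<phi> \<equiv> \<lambda>S A. \<Prod>x\<in>S. if x \<in> A then 1 else - 1 :: real"
  shows "(\<Prod>x\<in>X. if x \<in> A \<longleftrightarrow> x \<in> B then p + q else p - q)
    = (\<Sum>S\<in>Pow X. q ^ card S * p ^ (card X - card S) * (\<phi> S A * \<phi> S B))"
proof -
  have "(\<Prod>x\<in>X. if x \<in> A \<longleftrightarrow> x \<in> B then p + q else p - q)
     = (\<Prod>x\<in>X. q * ((if x \<in> A then 1 else - 1) * (if x \<in> B then 1 else - 1)) + p)"
    by (intro prod.cong) auto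
  also have "\<dots> = (\<Sum>S\<in>Pow X. q ^ card S * p ^ (card X - card S) * (\<phi> S A * \<phi> S B))"
    unfolding prod_add[OF assms(1)] \<phi>_def prod.distrib
    by (intro sum.cong refl)
      (use assms(1) in \<open>auto simp: card_Diff_subset finite_subset mult_ac\<close>)
  finally show ?thesis .
qed

text \<open>Exchanging the two values replaces \<open>q\<close> by \<open>- q\<close>. The
  coefficient of each character in the sum thus vanishes for odd \<open>card S\<close> and is
  nonnegative for even \<open>card S\<close>, and each \<open>S\<close> contributes its coefficient
  times a square.\<close>

lemma prod_agree_sym_psd:
  fixes p q :: real and A :: "'i \<Rightarrow> 'b set"
  assumes X: "finite X" and p: "p \<ge> 0"
  shows "(\<Sum>i\<in>I. \<Sum>j\<in>I. v i * v j *
     ((\<Prod>x\<in>X. if x \<in> A i \<longleftrightarrow> x \<in> A j then p + q else p - q) +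
      (\<Prod>x\<in>X. if x \<in> A i \<longleftrightarrow> x \<in> A j then p - q else p + q))) \<ge> 0"
proof -
  define \<phi> where "\<phi> = (\<lambda>S A. \<Prod>x\<in>S. if x \<in> (A::'b set) then 1 else - 1 :: real)"
  define c where "c S = (q ^ card S + (- q) ^ card S) * p ^ (card X - card S)" for S :: "'b set"
  have c: "c S \<ge> 0" for S
    unfolding c_def using p by (cases "even (card S)") (auto simp: zero_le_even_power)
  have "(\<Prod>x\<in>X. if x \<in> A i \<longleftrightarrow> x \<in> A j then p + q else p - q) +
      (\<Prod>x\<in>X. if x \<in> A i \<longleftrightarrow> x \<in> A j then p - q else p + q)
    = (\<Sum>S\<in>Pow X. c S * (\<phi> S (A i) * \<phi> S (A j)))" for i j
    using prod_agree_expand[OF X, of "A i" "A j" p q]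
      prod_agree_expand[OF X, of "A i" "A j" p "- q"]
    by (simp only: \<phi>_def sum.distrib[symmetric] c_def distrib_right
        diff_minus_eq_add add_uminus_conv_diff)
  then have "(\<Sum>i\<in>I. \<Sum>j\<in>I. v i * v j *
     ((\<Prod>x\<in>X. if x \<in> A i \<longleftrightarrow> x \<in> A j then p + q else p - q) +
      (\<Prod>x\<in>X. if x \<in> A i \<longleftrightarrow> x \<in> A j then p - q else p + q)))
    = (\<Sum>i\<in>I. \<Sum>j\<in>I. \<Sum>S\<in>Pow X. c S * ((v i * \<phi> S (A i)) * (v j * \<phi> S (A j))))"
    by (simp only: sum_distrib_left mult_ac)
  also have "\<dots> = (\<Sum>S\<in>Pow X. \<Sum>i\<in>I. \<Sum>j\<in>I. c S * ((v i * \<phi> S (A i)) * (v j * \<phi> S (A j))))"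
    by (subst sum.swap[of _ "Pow X" I], subst sum.swap[of _ "Pow X" I]) (rule refl)
  also have "\<dots> = (\<Sum>S\<in>Pow X. c S * (\<Sum>i\<in>I. v i * \<phi> S (A i))\<^sup>2)"
    unfolding power2_eq_square sum_product unfolding sum_distrib_left ..
  also have "\<dots> \<ge> 0" by (intro sum_nonneg mult_nonneg_nonneg c) auto
  finally show ?thesis .
qed

text \<open>Two \<open>n\<close>-subsets of a set of size \<open>2 * n\<close> share as many points
  as they jointly omit, so they agree at \<open>2 * card (A \<inter> B)\<close> points. The
  exponents are even, which lets square roots be substituted for \<open>a\<close> and
  \<open>b\<close>.\<close>

lemma prod_agree:
  fixes a b :: "'a :: comm_semiring_1"
  assumes X: "finite X" "card X = 2 * n" and A: "A \<subseteq> X" "card A = n" and B: "B \<subseteq> X" "card B = n"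
  shows "(\<Prod>x\<in>X. if x \<in> A \<longleftrightarrow> x \<in> B then a else b)
     = (a\<^sup>2) ^ card (A \<inter> B) * (b\<^sup>2) ^ (n - card (A \<inter> B))"
proof -
  let ?E = "{x \<in> X. x \<in> A \<longleftrightarrow> x \<in> B}"
  have fin: "finite A" "finite B" using A B X finite_subset by auto
  have k: "card (A \<inter> B) \<le> n" using A fin by (metis card_mono inf_le1)
  have E: "?E = (A \<inter> B) \<union> (X - (A \<union> B))" using A B by auto
  have "card (A \<union> B) + card (A \<inter> B) = 2 * n" using card_Un_Int[OF fin] A B by simp
  moreover have "card (X - (A \<union> B)) = 2 * n - card (A \<union> B)"
    using A B X fin by (simp add: card_Diff_subset)
  moreover have "card ?E = card (A \<inter> B) + card (X - (A \<union> B))"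
    unfolding E by (rule card_Un_disjoint) (use fin X in auto)
  ultimately have cE: "card ?E = 2 * card (A \<inter> B)" by linarith
  have "card (X - ?E) = 2 * (n - card (A \<inter> B))"
    using X cE k by (subst card_Diff_subset) auto
  moreover have "X \<inter> - ?E = X - ?E" by auto
  moreover have "(\<Prod>x\<in>X. if x \<in> A \<longleftrightarrow> x \<in> B then a else b)
     = (\<Prod>x\<in>X. if x \<in> ?E then a else b)"
    by (intro prod.cong) auto
  moreover have "X \<inter> ?E = ?E" by auto
  ultimately show ?thesis
    using cE by (simp only: prod.If_cases[OF X(1)] Collect_mem_eq prod_constant power_mult)
qed

text \<open>Up to a positive factor the form is the integral over \<open>{0..1}\<close> of a
  continuous \<open>Q\<close> that is nonnegative there. If it is zero, \<open>Q\<close> vanishes on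
  the whole interval, and \<open>Q 1\<close> is the sum of the squares of the
  \<open>v i\<close>.\<close>

lemma gram_definite:
  fixes v :: "'i \<Rightarrow> real" and A :: "'i \<Rightarrow> 'b set"
  assumes X: "finite X" "card X = 2 * n"
    and I: "finite I" "inj_on A I"
    and A: "\<And>i. i \<in> I \<Longrightarrow> A i \<subseteq> X" "\<And>i. i \<in> I \<Longrightarrow> card (A i) = n"
    and x: "\<And>i. i \<in> I \<Longrightarrow> x \<in> A i"
    and zero: "(\<Sum>i\<in>I. \<Sum>j\<in>I. v i * v j * (fact (card (A i \<inter> A j)) * fact (n - card (A i \<inter> A j)))) = 0"
    and i: "i \<in> I"
  shows "v i = 0"
proof -
  define k where "k i j = card (A i \<inter> A j)" for i j
  have finA: "finite (A i)" if "i \<in> I" for i by (rule finite_subset[OF A(1)[OF that] X(1)])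
  have k_le: "k i j \<le> n" if "i \<in> I" for i j
    unfolding k_def using A finA that by (metis card_mono inf_le1)
  define Q where "Q t = (\<Sum>i\<in>I. \<Sum>j\<in>I. v i * v j *
      (t ^ k i j * (1 - t) ^ (n - k i j) + (1 - t) ^ k i j * t ^ (n - k i j)))" for t :: real
  \<comment> \<open>Adding the term with \<open>t\<close> and \<open>1 - t\<close> exchanged cancels the characters \<open>\<phi> S\<close> with \<open>card S\<close> odd,
    the only ones whose eigenvalue can be negative.\<close>
  have Q_nonneg: "Q t \<ge> 0" if t: "t \<in> {0..1}" for t
  proof -
    \<comment> \<open>Solving \<open>p + q = a\<close> and \<open>p - q = b\<close> gives
      \<open>p = (a + b) / 2\<close> and \<open>q = (a - b) / 2\<close>; here
      \<open>p \<ge> 0\<close> although \<open>q\<close> may be negative.\<close>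
    define a b where "a = sqrt t" and "b = sqrt (1 - t)"
    have ab: "a\<^sup>2 = t" "b\<^sup>2 = 1 - t" "(a + b) / 2 \<ge> 0" using t by (auto simp: a_def b_def)
    have pq: "(a + b) / 2 + (a - b) / 2 = a" "(a + b) / 2 - (a - b) / 2 = b"
      by (auto simp: field_simps)
    have "Q t = (\<Sum>i\<in>I. \<Sum>j\<in>I. v i * v j *
     ((\<Prod>x\<in>X. if x \<in> A i \<longleftrightarrow> x \<in> A j then a else b) +
      (\<Prod>x\<in>X. if x \<in> A i \<longleftrightarrow> x \<in> A j then b else a)))"
      unfolding Q_def k_def
      by (intro sum.cong refl) (simp add: prod_agree[OF X] A ab)
    also have "\<dots> \<ge> 0"
      using prod_agree_sym_psd[OF X(1) ab(3), where q = "(a - b) / 2" and I = I and v = v and A = A]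
      unfolding pq .
    finally show ?thesis .
  qed
  have "(Q has_integral (\<Sum>i\<in>I. \<Sum>j\<in>I. v i * v j *
      (fact (k i j) * fact (n - k i j) / fact (k i j + (n - k i j) + 1)
     + fact (n - k i j) * fact (k i j) / fact (n - k i j + k i j + 1)))) {0..1}"
    unfolding Q_def
    by (intro has_integral_sum I has_integral_mult_right has_integral_add beta_integral)
      (subst mult.commute, rule beta_integral)
  \<comment> \<open>Since \<open>k i j + (n - k i j) = n\<close>, all denominators are
    \<open>fact (n + 1)\<close>; the two symmetric halves have equal integrals, whence the factor
    2.\<close>
  also have "(\<Sum>i\<in>I. \<Sum>j\<in>I. v i * v j *
      (fact (k i j) * fact (n - k i j) / fact (k i j + (n - k i j) + 1)
     + fact (n - k i j) * fact (k i j) / fact (n - k i j + k i j + 1)))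
    = 2 / fact (n + 1) * (\<Sum>i\<in>I. \<Sum>j\<in>I. v i * v j * (fact (k i j) * fact (n - k i j)))"
    unfolding sum_distrib_left by (intro sum.cong refl) (simp add: k_le field_simps)
  also have "\<dots> = 0" using zero unfolding k_def by simp
  finally have int: "(Q has_integral 0) (cbox 0 1)" by simp
  have "Q 1 = 0"
  proof (rule has_integral_0_cbox_imp_0[OF _ _ int])
    show "continuous_on (cbox 0 1) Q" unfolding Q_def by (intro continuous_intros)
  qed (use Q_nonneg in auto)
  \<comment> \<open>At \<open>t = 1\<close> the kernel is the identity: the common element \<open>x\<close> excludes complementary sets, and \<open>0 ^ 0 = 1\<close>.\<close>
  moreover have "Q 1 = (\<Sum>i\<in>I. (v i)\<^sup>2)"
    unfolding Q_def
  proof (intro sum.cong refl)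
    fix i assume i: "i \<in> I"
    have "v i * v j * (1 ^ k i j * (1 - 1) ^ (n - k i j) + (1 - 1) ^ k i j * 1 ^ (n - k i j))
       = (if j = i then (v i)\<^sup>2 else 0)" if j: "j \<in> I" for j
    proof -
      have "x \<in> A i \<inter> A j" using x i j by auto
      then have pos: "k i j > 0" unfolding k_def using finA[OF i] by (auto simp: card_gt_0_iff)
      have "k i j = n \<longleftrightarrow> A i = A j"
      proof
        assume "k i j = n"
        then have "A i \<inter> A j = A i" "A i \<inter> A j = A j"
          unfolding k_def using A finA i j by (metis card_subset_eq inf_le1, metis card_subset_eq inf_le2)
        then show "A i = A j" by simp
      qed (simp add: k_def A j)
      also have "\<dots> \<longleftrightarrow> j = i" using I i j by (auto dest: inj_onD)
      finally have "n - k i j = 0 \<longleftrightarrow> j = i" using k_le[OF i, of j] by linarith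
      then show ?thesis using pos by (auto simp: power_0_left power2_eq_square)
    qed
    then show "(\<Sum>j\<in>I. v i * v j * (1 ^ k i j * (1 - 1) ^ (n - k i j) + (1 - 1) ^ k i j * 1 ^ (n - k i j)))
        = (v i)\<^sup>2"
      using I i by simp
  qed
  ultimately have "\<forall>i\<in>I. (v i)\<^sup>2 = 0"
    using I by (simp add: sum_nonneg_eq_0_iff)
  then show ?thesis using i by simp
qed

subsection \<open>Matrices\<close>

text \<open>\<open>K\<close> maps \<open>R *\<^sub>v y\<close> to \<open>y\<close>, so its columns
  span the whole space. A vector killed by \<open>K\<^sup>T\<close> is killed by
  \<open>(K * R)\<^sup>T = 1\<close>, so the rows are independent.\<close>

lemma right_invertible_full_row_rank:
  fixes K :: "'a::field mat"
  assumes K: "K \<in> carrier_mat r m" and R: "R \<in> carrier_mat m r" and KR: "K * R = 1\<^sub>m r"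
  shows "mat_rank K = r" and "r \<le> m" and "rows_lin_indpt K"
proof -
  interpret V: vec_space "TYPE('a)" r .
  have "V.col_space K = carrier_vec r"
  proof -
    have "\<exists>x\<in>carrier_vec m. K *\<^sub>v x = y" if y: "y \<in> carrier_vec r" for y
    proof
      show "R *\<^sub>v y \<in> carrier_vec m" using R y by simp
      show "K *\<^sub>v (R *\<^sub>v y) = y"
        using assoc_mult_mat_vec[OF K R y] KR y by simp
    qed
    then show ?thesis using V.col_space_eq[OF K] K by auto
  qed
  then have "V.span_vs (set (cols K)) = module_vec TYPE('a) r"
    by (simp add: V.col_space_def module_vec_def)
  then have "V.rank K = r"
    unfolding V.rank_def using V.dim_is_n by simp
  then show rank: "mat_rank K = r"
    using K by (auto simp: mat_rank_def)
  show "r \<le> m"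
    using V.rank_le_nc[OF K] \<open>V.rank K = r\<close> by simp
  have dist: "distinct (Matrix.rows K)"
  proof (subst distinct_conv_nth, intro allI impI)
    fix i j assume "i < length (Matrix.rows K)" "j < length (Matrix.rows K)" "i \<noteq> j"
    then have ij: "i < r" "j < r" "i \<noteq> j" using K by auto
    show "Matrix.rows K ! i \<noteq> Matrix.rows K ! j"
    proof
      assume "Matrix.rows K ! i = Matrix.rows K ! j"
      then have "Matrix.row K i = Matrix.row K j" using ij K by simp
      \<comment> \<open>In the identity matrix these two entries are 1 and 0.\<close>
      then have "(K * R) $$ (i, i) = (K * R) $$ (j, i)" using ij K R by simp
      then show False using ij by (simp add: KR)
    qed
  qed
  interpret W: vec_space "TYPE('a)" m .
  have KT: "K\<^sup>T \<in> carrier_mat m r" and RT: "R\<^sup>T \<in> carrier_mat r m" using K R by auto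
  have "W.lin_indpt (set (cols K\<^sup>T))"
  proof
    assume "W.lin_dep (set (cols K\<^sup>T))"
    then obtain v where v: "v \<in> carrier_vec r" "v \<noteq> 0\<^sub>v r" "K\<^sup>T *\<^sub>v v = 0\<^sub>v m"
      using W.lin_depE[OF KT] dist by auto
    have "v = (K * R)\<^sup>T *\<^sub>v v" using v by (simp add: KR)
    also have "\<dots> = R\<^sup>T *\<^sub>v (K\<^sup>T *\<^sub>v v)"
      unfolding transpose_mult[OF K R] by (rule assoc_mult_mat_vec[OF RT KT v(1)])
    also have "\<dots> = 0\<^sub>v r" using v RT by auto
    finally show False using v by simp
  qed
  then show "rows_lin_indpt K"
    using dist K by (simp add: rows_lin_indpt_def)
qed

text \<open>Definiteness is an argument over the reals, the claim concerns any field of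
  characteristic 0. The determinant of the integer matrix \<open>G\<close> links them, as
  \<open>of_int\<close> commutes with \<open>det\<close> and is injective into both fields.\<close>

lemma gram_det_nonzero:
  fixes A :: "nat \<Rightarrow> 'b set"
  assumes X: "finite X" "card X = 2 * n"
    and inj: "inj_on A {..<r}"
    and A: "\<And>i. i < r \<Longrightarrow> A i \<subseteq> X" "\<And>i. i < r \<Longrightarrow> card (A i) = n"
    and x: "\<And>i. i < r \<Longrightarrow> x \<in> A i"
  shows "Determinant.det (Matrix.mat r r (\<lambda>(i, j). of_nat (fact (card (A i \<inter> A j)) * fact (n - card (A i \<inter> A j)))))
           \<noteq> (0 :: 'a::field_char_0)"
proof -
  define g :: "nat \<Rightarrow> nat \<Rightarrow> nat"
    where "g i j = fact (card (A i \<inter> A j)) * fact (n - card (A i \<inter> A j))" for i j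
  define G where "G = Matrix.mat r r (\<lambda>(i, j). int (g i j))"
  have "Determinant.det (map_mat real_of_int G) \<noteq> 0"
  proof
    have G: "map_mat real_of_int G \<in> carrier_mat r r" by (simp add: G_def)
    assume "Determinant.det (map_mat real_of_int G) = 0"
    then obtain v where v: "v \<in> carrier_vec r" "v \<noteq> 0\<^sub>v r" "map_mat real_of_int G *\<^sub>v v = 0\<^sub>v r"
      unfolding det_0_iff_vec_prod_zero_field[OF G] by blast
    have row: "(\<Sum>j<r. real (g i j) * vec_index v j) = 0" if i: "i < r" for i
    proof -
      have "(\<Sum>j<r. real (g i j) * vec_index v j) = vec_index (map_mat real_of_int G *\<^sub>v v) i"
        using i v(1) by (simp add: G_def scalar_prod_def lessThan_atLeast0)
      then show ?thesis using v(3) i by simp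
    qed
    \<comment> \<open>The quadratic form at a kernel vector \<open>v\<close> is the scalar product
      of \<open>v\<close> with \<open>G\<close> applied to \<open>v\<close>.\<close>
    have "(\<Sum>i<r. \<Sum>j<r. vec_index v i * vec_index v j *
        (fact (card (A i \<inter> A j)) * fact (n - card (A i \<inter> A j))))
      = (\<Sum>i<r. vec_index v i * (\<Sum>j<r. real (g i j) * vec_index v j))"
      unfolding sum_distrib_left by (intro sum.cong refl) (simp add: g_def mult_ac)
    also have "\<dots> = 0" using row by simp
    finally have zero: "(\<Sum>i<r. \<Sum>j<r. vec_index v i * vec_index v j *
        (fact (card (A i \<inter> A j)) * fact (n - card (A i \<inter> A j)))) = 0" .
    have "vec_index v i = 0" if "i < r" for i
      by (rule gram_definite[OF X finite_lessThan inj _ _ _ zero]) (use A x that in auto)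
    then have "v = 0\<^sub>v r" using v(1) by (intro eq_vecI) auto
    with v(2) show False ..
  qed
  then have "Determinant.det G \<noteq> 0" by (simp add: of_int_hom.hom_det)
  then have "Determinant.det (map_mat of_int G) \<noteq> (0 :: 'a)" by (simp add: of_int_hom.hom_det)
  moreover have "map_mat of_int G = Matrix.mat r r (\<lambda>(i, j). of_nat (g i j) :: 'a)"
    by (rule eq_matI) (auto simp: G_def)
  ultimately show ?thesis by (simp add: g_def)
qed

lemma det_nonzero_right_inverse:
  fixes G :: "'a::field mat"
  assumes G: "G \<in> carrier_mat r r" and det: "Determinant.det G \<noteq> 0"
  obtains H where "H \<in> carrier_mat r r" "G * H = 1\<^sub>m r"
  using det_non_zero_imp_unit[OF G det, of undefined]
  unfolding Units_def ring_mat_def by auto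

subsection \<open>Tableaux with two rows\<close>

text \<open>The count is the same for every \<open>Q\<close> of the given size, and the images \<open>p ` P\<close> exhaust these \<open>Q\<close>.\<close>
lemma card_permutes_image_eq:
  assumes fin: "finite S" and P: "P \<subseteq> S" and Q: "Q \<subseteq> S" and card: "card Q = card P"
  shows "card {p. p permutes S \<and> p ` P = Q} = fact (card P) * fact (card S - card P)"
proof -
  let ?N = "\<lambda>Q. {p. p permutes S \<and> p ` P = Q}"
  let ?F = "{R. R \<subseteq> S \<and> card R = card P}"
  have finN: "finite (?N R)" for R
    by (rule finite_subset[OF _ finite_permutations[OF fin]]) auto
  have le: "card (?N R) \<le> card (?N R')" if R: "R \<in> ?F" and R': "R' \<in> ?F" for R R'
  proof -
    have finR: "finite R" "finite R'" using R R' fin by (auto intro: finite_subset)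
    obtain g where g: "bij_betw g R R'"
      using finite_same_card_bij[OF finR] R R' by auto
    have "card (S - R) = card (S - R')" using R R' finR by (simp add: card_Diff_subset)
    then obtain h where h: "bij_betw h (S - R) (S - R')"
      using finite_same_card_bij[of "S - R" "S - R'"] fin by auto
    \<comment> \<open>Gluing \<open>g\<close> and \<open>h\<close> gives a permutation of
      \<open>S\<close> carrying \<open>R\<close> to \<open>R'\<close>; composing with it injects
      \<open>?N R\<close> into \<open>?N R'\<close>.\<close>
    define s where "s = (\<lambda>x. if x \<in> R then g x else if x \<in> S then h x else x)"
    have s1: "bij_betw s R R'" using g by (subst bij_betw_cong[where g = g]) (auto simp: s_def)
    have s2: "bij_betw s (S - R) (S - R')"
      using h by (subst bij_betw_cong[where g = h]) (auto simp: s_def)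
    have "bij_betw s (R \<union> (S - R)) (R' \<union> (S - R'))"
      by (rule bij_betw_combine[OF s1 s2]) auto
    moreover have "R \<union> (S - R) = S" "R' \<union> (S - R') = S" using R R' by auto
    ultimately have "bij_betw s S S" by simp
    moreover have "s x = x" if "x \<notin> S" for x using that R by (auto simp: s_def)
    ultimately have s: "s permutes S" by (rule bij_imp_permutes)
    show ?thesis
    proof (rule card_inj_on_le[where f = "\<lambda>p. s \<circ> p"])
      show "inj_on ((\<circ>) s) (?N R)"
        using permutes_inj[OF s] by (auto simp: inj_on_def fun_eq_iff)
      show "(\<circ>) s ` ?N R \<subseteq> ?N R'"
        using s s1 by (auto simp: permutes_compose image_comp[symmetric] bij_betw_def)
    qed (rule finN)
  qed
  have "fact (card S) = card {p. p permutes S}"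
    by (rule card_permutations[OF refl fin, symmetric])
  also have "{p. p permutes S} = (\<Union>R\<in>?F. ?N R)"
  proof -
    have "p ` P \<subseteq> S \<and> card (p ` P) = card P" if "p permutes S" for p
      using that P by (metis card_image image_mono permutes_image permutes_inj_on)
    then show ?thesis by auto
  qed
  also have "card \<dots> = (\<Sum>R\<in>?F. card (?N R))"
    by (rule card_UN_disjoint) (use fin finN in auto)
  also have "\<dots> = (\<Sum>R\<in>?F. card (?N Q))"
    using le Q card by (intro sum.cong refl antisym) auto
  also have "\<dots> = (card S choose card P) * card (?N Q)"
    using n_subsets[OF fin] by simp
  finally have "(card S choose card P) * card (?N Q)
      = (card S choose card P) * (fact (card P) * fact (card S - card P))"
    using binomial_fact_lemma[of "card P" "card S"] card_mono[OF fin P] by (simp add: mult_ac)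
  moreover have "card S choose card P > 0" using card_mono[OF fin P] by simp
  ultimately show ?thesis by simp
qed

section \<open>Rows and columns of the two-row diagram\<close>

lemma cells_two_rows: "(i, j) \<in> cells (replicate 2 n) \<longleftrightarrow> i < 2 \<and> j < n"
  by (auto simp: cells_def)

lemma num_cols_two_rows: "num_cols (replicate 2 n) = n"
  by (simp add: num_cols_def numeral_2_eq_2)

lemma tableau_rows_two_rows:
  "tableau_rows (replicate 2 n) T = {(\<lambda>j. T (0, j)) ` {..<n}, (\<lambda>j. T (1, j)) ` {..<n}}"
proof -
  have "{T (i, j) | j. (i, j) \<in> cells (replicate 2 n)} = (\<lambda>j. T (i, j)) ` {..<n}" if "i < 2" for i
    using that by (auto simp: cells_two_rows)
  then have "(\<lambda>i. {T (i, j) | j. (i, j) \<in> cells (replicate 2 n)}) ` {..<2}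
      = (\<lambda>i. (\<lambda>j. T (i, j)) ` {..<n}) ` {..<2}"
    by (intro image_cong) auto
  moreover have "tableau_rows (replicate 2 n) T
      = (\<lambda>i. {T (i, j) | j. (i, j) \<in> cells (replicate 2 n)}) ` {..<2}"
    by (auto simp: tableau_rows_def)
  ultimately have "tableau_rows (replicate 2 n) T = (\<lambda>i. (\<lambda>j. T (i, j)) ` {..<n}) ` {..<2}"
    by simp
  also have "{..<2} = {0, 1::nat}" by auto
  finally show ?thesis by simp
qed

lemma tableau_cols_two_rows:
  "tableau_cols (replicate 2 n) T = (\<lambda>j. {T (0, j), T (1, j)}) ` {..<n}"
proof -
  have "{T (i, j) | i. (i, j) \<in> cells (replicate 2 n)} = {T (0, j), T (1, j)}" if "j < n" for j
    using that by (auto simp: cells_two_rows less_2_cases_iff)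
  then show ?thesis
    unfolding tableau_cols_def num_cols_two_rows by auto
qed

lemma tableau_two_rowsD:
  assumes "T \<in> tableaux (replicate 2 n)"
  shows "inj_on (\<lambda>j. T (0, j)) {..<n}" "inj_on (\<lambda>j. T (1, j)) {..<n}"
    and "(\<lambda>j. T (1, j)) ` {..<n} = {1..2 * n} - (\<lambda>j. T (0, j)) ` {..<n}"
    and "(\<lambda>j. T (0, j)) ` {..<n} \<subseteq> {1..2 * n}"
proof -
  have "cells (replicate 2 n) = {0, 1} \<times> {..<n}" by (auto simp: cells_two_rows)
  then have T: "inj_on T ({0, 1} \<times> {..<n})" "T ` ({0, 1} \<times> {..<n}) = {1..2 * n}"
    using assms by (auto simp: tableaux_def bij_betw_def sum_list_replicate)
  then show "inj_on (\<lambda>j. T (0, j)) {..<n}" "inj_on (\<lambda>j. T (1, j)) {..<n}"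
    by (auto simp: inj_on_def)
  have U: "T ` ({0, 1} \<times> {..<n}) = (\<lambda>j. T (0, j)) ` {..<n} \<union> (\<lambda>j. T (1, j)) ` {..<n}"
    by auto
  have "(\<lambda>j. T (0, j)) ` {..<n} \<inter> (\<lambda>j. T (1, j)) ` {..<n} = {}"
    using T(1) by (auto simp: inj_on_def)
  then show "(\<lambda>j. T (1, j)) ` {..<n} = {1..2 * n} - (\<lambda>j. T (0, j)) ` {..<n}"
    using U T(2) by blast
  show "(\<lambda>j. T (0, j)) ` {..<n} \<subseteq> {1..2 * n}" using U T(2) by blast
qed

text \<open>This turns a matching of \<open>B\<close> with its complement into a tableau: column
  \<open>j\<close> consists of \<open>b j\<close> and \<open>c j\<close>.\<close>

lemma tableau_two_rowsI:
  assumes "bij_betw b {..<n} B" "bij_betw c {..<n} ({1..2 * n} - B)" "B \<subseteq> {1..2 * n}"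
  shows "(\<lambda>x\<in>cells (replicate 2 n). if fst x = 0 then b (snd x) else c (snd x)) \<in> tableaux (replicate 2 n)"
proof -
  have cells: "cells (replicate 2 n) = {0} \<times> {..<n} \<union> {1} \<times> {..<n}" by (auto simp: cells_two_rows)
  let ?f = "\<lambda>x::nat \<times> nat. if fst x = 0 then b (snd x) else c (snd x)"
  have snd: "bij_betw (g \<circ> snd) ({i} \<times> {..<n}) C" if "bij_betw g {..<n} C" for g :: "nat \<Rightarrow> nat" and i :: nat and C
    by (rule bij_betw_trans[OF _ that]) (auto simp: bij_betw_def inj_on_def)
  have "bij_betw ?f ({0} \<times> {..<n}) B"
    by (rule bij_betw_cong[THEN iffD1, OF _ snd[OF assms(1)]]) auto
  moreover have "bij_betw ?f ({1} \<times> {..<n}) ({1..2 * n} - B)"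
    by (rule bij_betw_cong[THEN iffD1, OF _ snd[OF assms(2)]]) auto
  ultimately have "bij_betw ?f (cells (replicate 2 n)) (B \<union> ({1..2 * n} - B))"
    unfolding cells by (rule bij_betw_combine) auto
  moreover have "B \<union> ({1..2 * n} - B) = {1..2 * n}" using assms(3) by blast
  ultimately have "bij_betw ?f (cells (replicate 2 n)) {1..2 * n}" by simp
  then show ?thesis
    by (simp add: tableaux_def sum_list_replicate bij_betw_restrict_eq)
qed

section \<open>Horizontal tableaux as pairs of complementary sets\<close>

text \<open>Taking the row that contains 1 names the unordered pair of rows by a single set and
  provides a common element of all these sets. The bound \<open>n \<ge> 1\<close> puts 1 into
  \<open>{1..2 * n}\<close>.\<close>

lemma horizontal_tableau_rows:
  assumes n: "n \<ge> 1" and \<mu>: "\<mu> \<in> horizontal_tableaux (replicate 2 n)"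
  obtains A where "1 \<in> A" "A \<subseteq> {1..2 * n}" "card A = n" "h_rows (replicate 2 n) \<mu> = {A, {1..2 * n} - A}"
proof -
  obtain S where S: "S \<in> tableaux (replicate 2 n)" and \<mu>S: "\<mu> = h_equiv (replicate 2 n) `` {S}"
    using \<mu> by (auto simp: horizontal_tableaux_def elim: quotientE)
  define R where "R = (\<lambda>j. S (0, j)) ` {..<n}"
  note D = tableau_two_rowsD[OF S, folded R_def]
  have rows: "h_rows (replicate 2 n) \<mu> = {R, {1..2 * n} - R}"
    unfolding \<mu>S h_rows_eq[OF S] tableau_rows_two_rows D(3) by (simp add: R_def)
  have card: "card R = n" unfolding R_def using card_image[OF D(1)] by simp
  have card': "card ({1..2 * n} - R) = n" unfolding D(3)[symmetric] using card_image[OF D(2)] by simp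
  have "{1..2 * n} - ({1..2 * n} - R) = R" using D(4) by blast
  then have rows': "h_rows (replicate 2 n) \<mu> = {{1..2 * n} - R, {1..2 * n} - ({1..2 * n} - R)}"
    using rows by auto
  show ?thesis
  proof (cases "1 \<in> R")
    case True
    then show ?thesis using that[OF True D(4) card rows] by blast
  next
    case False
    then show ?thesis using that[OF _ _ card' rows'] n by auto
  qed
qed

text \<open>Equal unordered pairs of rows agree in order or after a swap, which determines
  \<open>\<rho>\<close>; within a row, \<open>\<pi> i\<close> locates the entries of
  \<open>T\<close> among those of \<open>S\<close>.\<close>

lemma h_equiv_two_rowsI:
  assumes S: "S \<in> tableaux (replicate 2 n)" and T: "T \<in> tableaux (replicate 2 n)"
    and eq: "tableau_rows (replicate 2 n) S = tableau_rows (replicate 2 n) T"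
  shows "(S, T) \<in> h_equiv (replicate 2 n)"
proof -
  define rS where "rS i = (\<lambda>j. S (i, j)) ` {..<n}" for i
  define rT where "rT i = (\<lambda>j. T (i, j)) ` {..<n}" for i
  have "{rS 0, rS 1} = {rT 0, rT 1}"
    using eq by (simp add: tableau_rows_two_rows rS_def rT_def)
  then have "rS 0 = rT 0 \<and> rS 1 = rT 1 \<or> rS 1 = rT 0 \<and> rS 0 = rT 1"
    by (auto simp: doubleton_eq_iff)
  then obtain \<rho> where \<rho>: "\<rho> permutes {..<2::nat}" and r: "\<And>i. i < 2 \<Longrightarrow> rS (\<rho> i) = rT i"
  proof
    assume "rS 0 = rT 0 \<and> rS 1 = rT 1"
    then show ?thesis
      by (intro that[of id]) (auto simp: permutes_id less_2_cases_iff)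
  next
    assume "rS 1 = rT 0 \<and> rS 0 = rT 1"
    then show ?thesis
      by (intro that[of "Transposition.transpose 0 1"] permutes_swap_id) (auto simp: less_2_cases_iff)
  qed
  have injS: "inj_on (\<lambda>j. S (i, j)) {..<n}" if "i < 2" for i
    using tableau_two_rowsD(1,2)[OF S] that by (auto simp: less_2_cases_iff)
  have injT: "inj_on (\<lambda>j. T (i, j)) {..<n}" if "i < 2" for i
    using tableau_two_rowsD(1,2)[OF T] that by (auto simp: less_2_cases_iff)
  \<comment> \<open>Off the row \<open>\<pi> i\<close> is the identity, as \<open>permutes\<close>
    demands.\<close>
  define \<pi> where "\<pi> i j = (if j < n then inv_into {..<n} (\<lambda>j. S (\<rho> i, j)) (T (i, j)) else j)" for i j
  have "\<pi> i permutes {..<n} \<and> (\<forall>j<n. T (i, j) = S (\<rho> i, \<pi> i j))" if i: "i < 2" for i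
  proof
    have \<rho>i: "\<rho> i < 2" using permutes_in_image[OF \<rho>, of i] i by simp
    have S': "bij_betw (\<lambda>j. S (\<rho> i, j)) {..<n} (rS (\<rho> i))"
      unfolding rS_def using injS[OF \<rho>i] by (rule inj_on_imp_bij_betw)
    have T': "bij_betw (\<lambda>j. T (i, j)) {..<n} (rS (\<rho> i))"
      unfolding r[OF i] unfolding rT_def using injT[OF i] by (rule inj_on_imp_bij_betw)
    have "bij_betw (inv_into {..<n} (\<lambda>j. S (\<rho> i, j)) \<circ> (\<lambda>j. T (i, j))) {..<n} {..<n}"
      by (rule bij_betw_trans[OF T' bij_betw_inv_into[OF S']])
    then have "bij_betw (\<pi> i) {..<n} {..<n}"
      by (rule bij_betw_cong[THEN iffD1, rotated]) (simp add: \<pi>_def)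
    then show "\<pi> i permutes {..<n}"
      by (rule bij_imp_permutes) (simp add: \<pi>_def)
    show "\<forall>j<n. T (i, j) = S (\<rho> i, \<pi> i j)"
    proof (intro allI impI)
      fix j assume j: "j < n"
      then have "T (i, j) \<in> rS (\<rho> i)" using T' by (auto simp: bij_betw_def)
      from bij_betw_inv_into_right[OF S' this] j
      show "T (i, j) = S (\<rho> i, \<pi> i j)" by (simp add: \<pi>_def)
    qed
  qed
  then have "\<forall>i<length (replicate 2 n). replicate 2 n ! \<rho> i = replicate 2 n ! i \<and>
      \<pi> i permutes {..<replicate 2 n ! i} \<and> (\<forall>j<replicate 2 n ! i. T (i, j) = S (\<rho> i, \<pi> i j))"
    using permutes_in_image[OF \<rho>] by (auto simp: nth_replicate)
  then show ?thesis
    unfolding h_equiv_def using S T \<rho>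
    by (intro CollectI case_prodI conjI exI[of _ \<rho>] exI[of _ \<pi>]) (simp_all)
qed

text \<open>This makes the passage from a horizontal tableau to its row containing 1
  injective.\<close>

lemma horizontal_tableau_eqI:
  assumes "\<mu> \<in> horizontal_tableaux (replicate 2 n)" "\<mu>' \<in> horizontal_tableaux (replicate 2 n)"
    and "h_rows (replicate 2 n) \<mu> = h_rows (replicate 2 n) \<mu>'"
  shows "\<mu> = \<mu>'"
proof -
  obtain S S' where S: "S \<in> tableaux (replicate 2 n)" "\<mu> = h_equiv (replicate 2 n) `` {S}"
    and S': "S' \<in> tableaux (replicate 2 n)" "\<mu>' = h_equiv (replicate 2 n) `` {S'}"
    using assms by (auto simp: horizontal_tableaux_def elim!: quotientE)
  have "(S, S') \<in> h_equiv (replicate 2 n)"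
    using assms(3) S S' by (intro h_equiv_two_rowsI) (simp_all add: h_rows_eq)
  then show ?thesis
    unfolding S S' by (rule equiv_class_eq[OF equiv_h_equiv])
qed

section \<open>Orthogonality and the count of crossing matchings\<close>

text \<open>A column has two distinct entries, so it meets each of the two rows at most once exactly
  when its entries lie in different rows.\<close>

lemma orthogonal_two_rows_iff:
  assumes T: "T \<in> tableaux (replicate 2 n)"
    and \<mu>: "h_rows (replicate 2 n) \<mu> = {A, {1..2 * n} - A}"
  shows "orthogonal_tableaux (replicate 2 n) \<mu> (v_equiv (replicate 2 n) `` {T})
    \<longleftrightarrow> (\<forall>j<n. T (0, j) \<in> A \<longleftrightarrow> T (1, j) \<notin> A)"
proof -
  have cols: "v_cols (replicate 2 n) (v_equiv (replicate 2 n) `` {T}) = (\<lambda>j. {T (0, j), T (1, j)}) ` {..<n}"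
    by (subst v_cols_eq[OF _ T]) (simp_all add: sorted_wrt_iff_nth_less tableau_cols_two_rows)
  have "card (A \<inter> {T (0, j), T (1, j)}) \<le> 1 \<and> card (({1..2 * n} - A) \<inter> {T (0, j), T (1, j)}) \<le> 1
      \<longleftrightarrow> (T (0, j) \<in> A \<longleftrightarrow> T (1, j) \<notin> A)" if j: "j < n" for j
  proof -
    have "T (0, j) \<in> {1..2 * n}" "T (1, j) \<in> {1..2 * n}" "T (0, j) \<noteq> T (1, j)"
      using tableau_two_rowsD(3,4)[OF T] j by blast+
    then show ?thesis
      by (cases "T (0, j) \<in> A"; cases "T (1, j) \<in> A") (auto simp: Int_insert_right card_insert_if)
  qed
  then show ?thesis
    unfolding orthogonal_tableaux_def \<mu> cols by (auto simp del: One_nat_def)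
qed

text \<open>The condition says that \<open>p\<close> carries the indices with
  \<open>b j \<in> A\<close> onto those with \<open>c j \<notin> A\<close>. Both index sets have
  \<open>card (A \<inter> B)\<close> elements, because the complement of \<open>A \<union> B\<close>
  is as large as \<open>A \<inter> B\<close>.\<close>

lemma card_crossing_permutations:
  assumes X: "finite X" "card X = 2 * n" and A: "A \<subseteq> X" "card A = n" and B: "B \<subseteq> X" "card B = n"
    and b: "bij_betw b {..<n} B" and c: "bij_betw c {..<n} (X - B)"
  shows "card {p. p permutes {..<n} \<and> (\<forall>j<n. b j \<in> A \<longleftrightarrow> c (p j) \<notin> A)}
    = fact (card (A \<inter> B)) * fact (n - card (A \<inter> B))"
proof -
  let ?P = "{j \<in> {..<n}. b j \<in> A}" and ?Q = "{j \<in> {..<n}. c j \<notin> A}"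
  have fin: "finite A" "finite B" using A B X finite_subset by auto
  have "bij_betw b ?P (A \<inter> B)"
    by (rule bij_betw_subset[OF b]) (use b in \<open>auto simp: bij_betw_def\<close>)
  then have P: "card ?P = card (A \<inter> B)" by (rule bij_betw_same_card)
  have "bij_betw c ?Q (X - (A \<union> B))"
    by (rule bij_betw_subset[OF c]) (use c in \<open>auto simp: bij_betw_def\<close>)
  then have "card ?Q = card (X - (A \<union> B))" by (rule bij_betw_same_card)
  also have "\<dots> = 2 * n - card (A \<union> B)"
    using A B X fin by (simp add: card_Diff_subset)
  also have "\<dots> = card (A \<inter> B)" using card_Un_Int[OF fin] A B by simp
  finally have Q: "card ?Q = card (A \<inter> B)" .
  have "(\<forall>j<n. b j \<in> A \<longleftrightarrow> c (p j) \<notin> A) \<longleftrightarrow> p ` ?P = ?Q" if p: "p permutes {..<n}" for p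
  proof
    have pn: "p j < n \<longleftrightarrow> j < n" for j using permutes_in_image[OF p, of j] by simp
    show "p ` ?P = ?Q" if "\<forall>j<n. b j \<in> A \<longleftrightarrow> c (p j) \<notin> A"
    proof
      show "p ` ?P \<subseteq> ?Q" using that pn by auto
      show "?Q \<subseteq> p ` ?P"
      proof
        fix y assume y: "y \<in> ?Q"
        then obtain j where "y = p j" "j < n" using permutes_image[OF p] by (metis (no_types, lifting) imageE lessThan_iff mem_Collect_eq)
        then show "y \<in> p ` ?P" using that y by auto
      qed
    qed
    show "\<forall>j<n. b j \<in> A \<longleftrightarrow> c (p j) \<notin> A" if "p ` ?P = ?Q"
    proof (intro allI impI)
      fix j assume j: "j < n"
      have "p j \<in> p ` ?P \<longleftrightarrow> j \<in> ?P" using permutes_inj[OF p] by (rule inj_image_mem_iff)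
      then show "b j \<in> A \<longleftrightarrow> c (p j) \<notin> A" unfolding that using j pn by simp
    qed
  qed
  then have "{p. p permutes {..<n} \<and> (\<forall>j<n. b j \<in> A \<longleftrightarrow> c (p j) \<notin> A)}
      = {p. p permutes {..<n} \<and> p ` ?P = ?Q}" by blast
  also have "card \<dots> = fact (card ?P) * fact (card {..<n} - card ?P)"
    by (rule card_permutes_image_eq) (use P Q in auto)
  finally show ?thesis unfolding P by simp
qed

subsection \<open>Full rank\<close>

theorem theorem2p1:
  fixes n :: nat and hs vs :: "tableau set list" and K :: "'a::field_char_0 mat"
  assumes "n \<ge> 1"
    and "distinct hs" and "set hs = horizontal_tableaux (replicate 2 n)"
    and "distinct vs" and "set vs = vertical_tableaux (replicate 2 n)"
    and "K = K_matrix (replicate 2 n) hs vs"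
  shows "mat_rank K = min (dim_row K) (dim_col K) \<and> rows_lin_indpt K"
proof -
  let ?lam = "replicate 2 n" and ?X = "{1..2 * n}" and ?r = "length hs" and ?m = "length vs"
  have K: "K \<in> carrier_mat ?r ?m" by (simp add: assms(6) K_matrix_def)
  have "\<forall>i\<in>{..<?r}. \<exists>A. 1 \<in> A \<and> A \<subseteq> ?X \<and> card A = n \<and> h_rows ?lam (hs ! i) = {A, ?X - A}"
  proof
    fix i assume "i \<in> {..<?r}"
    then have "hs ! i \<in> horizontal_tableaux ?lam" using assms(3) nth_mem by blast
    then show "\<exists>A. 1 \<in> A \<and> A \<subseteq> ?X \<and> card A = n \<and> h_rows ?lam (hs ! i) = {A, ?X - A}"
      by (rule horizontal_tableau_rows[OF assms(1)]) blast
  qed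
  then obtain A where "\<forall>i\<in>{..<?r}. 1 \<in> A i \<and> A i \<subseteq> ?X \<and> card (A i) = n \<and> h_rows ?lam (hs ! i) = {A i, ?X - A i}"
    unfolding bchoice_iff by blast
  then have A: "\<And>i. i < ?r \<Longrightarrow> 1 \<in> A i" "\<And>i. i < ?r \<Longrightarrow> A i \<subseteq> ?X" "\<And>i. i < ?r \<Longrightarrow> card (A i) = n"
    and rows: "\<And>i. i < ?r \<Longrightarrow> h_rows ?lam (hs ! i) = {A i, ?X - A i}"
    by auto
  have X: "finite ?X" "card ?X = 2 * n" by auto
  have inj: "inj_on A {..<?r}"
  proof (rule inj_onI)
    fix i j assume ij: "i \<in> {..<?r}" "j \<in> {..<?r}" "A i = A j"
    then have "h_rows ?lam (hs ! i) = h_rows ?lam (hs ! j)" using rows by auto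
    then have "hs ! i = hs ! j" using ij assms(3) nth_mem by (intro horizontal_tableau_eqI) blast+
    then show "i = j" using ij nth_eq_iff_index_eq[OF assms(2)] by simp
  qed
  have "\<forall>i\<in>{..<?r}. \<exists>bc. bij_betw (fst bc) {..<n} (A i) \<and> bij_betw (snd bc) {..<n} (?X - A i)"
  proof
    fix i assume i: "i \<in> {..<?r}"
    have fin: "finite (A i)" using A(2)[of i] i finite_subset[OF _ X(1)] by auto
    have "\<exists>b. bij_betw b {..<n} (A i)"
      using A(3)[of i] i fin by (intro finite_same_card_bij) auto
    moreover have "\<exists>c. bij_betw c {..<n} (?X - A i)"
      using A(2,3)[of i] i fin by (intro finite_same_card_bij) (auto simp: card_Diff_subset)
    ultimately show "\<exists>bc. bij_betw (fst bc) {..<n} (A i) \<and> bij_betw (snd bc) {..<n} (?X - A i)"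
      by auto
  qed
  then obtain bc where "\<forall>i\<in>{..<?r}. bij_betw (fst (bc i)) {..<n} (A i) \<and> bij_betw (snd (bc i)) {..<n} (?X - A i)"
    unfolding bchoice_iff by blast
  then have b: "\<And>i. i < ?r \<Longrightarrow> bij_betw (fst (bc i)) {..<n} (A i)"
    and c: "\<And>i. i < ?r \<Longrightarrow> bij_betw (snd (bc i)) {..<n} (?X - A i)"
    by auto
  define P where "P = {p. p permutes {..<n}}"
  have finP: "finite P" by (simp add: P_def finite_permutations)
  \<comment> \<open>With the first row fixed, permuting the second one runs through all matchings of
    \<open>A i\<close> with its complement.\<close>
  define T where "T i p = (\<lambda>x\<in>cells ?lam. if fst x = 0 then fst (bc i) (snd x) else (snd (bc i) \<circ> p) (snd x))" for i p
  define V where "V i p = v_equiv ?lam `` {T i p}" for i p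
  have T: "T i p \<in> tableaux ?lam" if "i < ?r" "p \<in> P" for i p
    unfolding T_def
  proof (rule tableau_two_rowsI[OF b[OF that(1)] _ A(2)[OF that(1)]])
    have "bij_betw p {..<n} {..<n}" using that(2) by (simp add: P_def permutes_imp_bij)
    then show "bij_betw (snd (bc i) \<circ> p) {..<n} (?X - A i)" using c[OF that(1)] by (rule bij_betw_trans)
  qed
  have orth: "orthogonal_tableaux ?lam (hs ! i) (V i' p)
      \<longleftrightarrow> (\<forall>j<n. fst (bc i') j \<in> A i \<longleftrightarrow> snd (bc i') (p j) \<notin> A i)"
    if "i < ?r" "i' < ?r" "p \<in> P" for i i' p
    unfolding V_def orthogonal_two_rows_iff[OF T[OF that(2,3)] rows[OF that(1)]]
    by (auto simp: T_def cells_two_rows)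
  \<comment> \<open>\<open>T i p\<close> has first row \<open>A i\<close>; column \<open>i\<close> of \<open>C\<close> counts these tableaux over all \<open>p\<close> by their vertical class.\<close>
  define C :: "'a mat" where "C = Matrix.mat ?m ?r (\<lambda>(j, i). of_nat (card {p \<in> P. V i p = vs ! j}))"
  define G :: "'a mat" where "G = Matrix.mat ?r ?r (\<lambda>(i, j). of_nat (fact (card (A i \<inter> A j)) * fact (n - card (A i \<inter> A j))))"
  have KC: "K * C = G"
  proof (rule eq_matI)
    fix i i' assume "i < dim_row G" "i' < dim_col G"
    then have i: "i < ?r" and i': "i' < ?r" by (auto simp: G_def)
    let ?o = "\<lambda>\<nu>. if orthogonal_tableaux ?lam (hs ! i) \<nu> then 1 else 0 :: 'a"
    have "(K * C) $$ (i, i') = (\<Sum>j<?m. ?o (vs ! j) * of_nat (card {p \<in> P. V i' p = vs ! j}))"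
      using i i' by (simp add: assms(6) K_matrix_def C_def scalar_prod_def lessThan_atLeast0)
    \<comment> \<open>The cardinality becomes a sum over \<open>p\<close>, so that the sum over
      \<open>vs\<close> can be carried out first.\<close>
    also have "\<dots> = (\<Sum>j<?m. \<Sum>p\<in>P. if V i' p = vs ! j then ?o (vs ! j) else 0)"
      using finP by (simp add: sum.If_cases Int_def mult.commute)
    also have "\<dots> = (\<Sum>p\<in>P. \<Sum>j<?m. if V i' p = vs ! j then ?o (vs ! j) else 0)"
      by (rule sum.swap)
    also have "\<dots> = (\<Sum>p\<in>P. ?o (V i' p))"
    proof (rule sum.cong[OF refl])
      fix p assume "p \<in> P"
      \<comment> \<open>\<open>vs\<close> lists each vertical tableau exactly once, so a single
        index \<open>k\<close> survives in the inner sum.\<close>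
      then have "V i' p \<in> set vs"
        unfolding assms(5) vertical_tableaux_def V_def by (intro quotientI T i')
      then obtain k where k: "k < ?m" "vs ! k = V i' p" by (auto simp: in_set_conv_nth)
      have "V i' p = vs ! j \<longleftrightarrow> j = k" if "j < ?m" for j
        unfolding k(2)[symmetric] using nth_eq_iff_index_eq[OF assms(4) k(1) that] by auto
      then have "(\<Sum>j<?m. if V i' p = vs ! j then ?o (vs ! j) else 0)
          = (\<Sum>j<?m. if j = k then ?o (V i' p) else 0)"
        using k(2) by (intro sum.cong refl) auto
      then show "(\<Sum>j<?m. if V i' p = vs ! j then ?o (vs ! j) else 0) = ?o (V i' p)"
        using k by simp
    qed
    also have "\<dots> = of_nat (card {p \<in> P. orthogonal_tableaux ?lam (hs ! i) (V i' p)})"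
      using finP by (simp add: sum.If_cases Int_def)
    also have "{p \<in> P. orthogonal_tableaux ?lam (hs ! i) (V i' p)}
       = {p. p permutes {..<n} \<and> (\<forall>j<n. fst (bc i') j \<in> A i \<longleftrightarrow> snd (bc i') (p j) \<notin> A i)}"
      using orth[OF i i'] by (auto simp: P_def)
    also have "card \<dots> = fact (card (A i \<inter> A i')) * fact (n - card (A i \<inter> A i'))"
      by (rule card_crossing_permutations[OF X A(2,3)[OF i] A(2,3)[OF i'] b[OF i'] c[OF i']])
    finally show "(K * C) $$ (i, i') = G $$ (i, i')" using i i' by (simp add: G_def)
  qed (use K in \<open>auto simp: G_def C_def\<close>)
  have "Determinant.det G \<noteq> 0"
    unfolding G_def by (rule gram_det_nonzero[OF X inj A(2,3,1)])
  moreover have G: "G \<in> carrier_mat ?r ?r" by (simp add: G_def)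
  ultimately obtain H where H: "H \<in> carrier_mat ?r ?r" "G * H = 1\<^sub>m ?r"
    using det_nonzero_right_inverse by blast
  have C: "C \<in> carrier_mat ?m ?r" by (simp add: C_def)
  have CH: "C * H \<in> carrier_mat ?m ?r" using C H by simp
  have "K * (C * H) = 1\<^sub>m ?r"
    using assoc_mult_mat[OF K C H(1)] KC H(2) by simp
  note full = right_invertible_full_row_rank[OF K CH this]
  \<comment> \<open>The right inverse also yields \<open>?r \<le> ?m\<close>, so the minimum of the
    dimensions is the number of rows.\<close>
  show ?thesis using full K by auto
qed

end
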